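(* Let $Y \in L^2(\Omega;\mathbb{R})$ and let $(Y_\ell)_{\ell \in \mathbb{N}_0} \subset L^2(\Omega;\mathbb{R})$ be such that $\lim_{\ell\to\infty} |\mathbb{E}[Y-Y_\ell]| = 0$. Let $L \in \mathbb{N}$ and let $N_0,\ldots,N_L \in \mathbb{N}$ be the sample sizes of the multilevel Monte Carlo estimator $E^L[Y_L]$. Then the sampling error of approximating $|\mathbb{E}[Y-Y_L]|$ by $|\mathbb{E}[Y]-E^L[Y_L]|$ is bounded from below by \[ \big\| |\mathbb{E}[Y - Y_L]| - |\mathbb{E}[Y] - E^L[Y_L]| \big\|_{L^2(\Omega;\mathbb{R})} \ge -|\mathbb{E}[Y-Y_L]| + \left(|\mathbb{E}[Y-Y_L]|^2 + N_0^{-1} \mathrm{Var}[Y_0] + \sum_{\ell=1}^L N_\ell^{-1} \mathrm{Var}[Y_\ell - Y_{\ell-1}]\right)^{1/2} \] and from above by \[ \big\| |\mathbb{E}[Y - Y_L]| - |\mathbb{E}[Y] - E^L[Y_L]| \big\|_{L^2(\Omega;\mathbb{R})} \le \left(N_0^{-1} \mathrm{Var}[Y_0] + \sum_{\ell=1}^L N_\ell^{-1} \mathrm{Var}[Y_\ell - Y_{\ell-1}]\right)^{1/2}. \]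
   Context: $(\Omega,\mathcal{A},P)$ is a probability space. $L^2(\Omega;\mathbb{R})$ is the space of real-valued random variables $Z$ with $\|Z\|_{L^2(\Omega;\mathbb{R})}^2 = \mathbb{E}[|Z|^2] < \infty$. For a real-valued random variable $Z$ and $N \in \mathbb{N}$, the Monte Carlo estimator is $E_N[Z] = N^{-1}\sum_{i=1}^N Z^{(i)}$, where $(Z^{(i)})_{i=1}^N$ is a sequence of independent, identically distributed random variables on $\Omega$ with the same law as $Z$. For a sequence of random variables $(Y_\ell)_{\ell\in\mathbb{N}_0}$, $L \in \mathbb{N}$ and level-specific sample sizes $(N_\ell)_{\ell=0}^L$, the multilevel Monte Carlo estimator is \[ E^L[Y_L] = E_{N_0}[Y_0] + \sum_{\ell=1}^L E_{N_\ell}[Y_\ell - Y_{\ell-1}], \] where the Monte Carlo estimators $E_{N_0}[Y_0], E_{N_1}[Y_1-Y_0],\ldots,E_{N_L}[Y_L-Y_{L-1}]$ on the different levels are mutually independent. *)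

theory Defs
  imports "HOL-Probability.Probability"
begin

definition L2_space :: "'a measure \<Rightarrow> ('a \<Rightarrow> real) set" where
  "L2_space M = {Z \<in> borel_measurable M. integrable M (\<lambda>\<omega>. \<bar>Z \<omega>\<bar>\<^sup>2)}"

text \<open>The Bochner integral is 0 for non-integrable functions, so \<open>L2_norm M Z\<close> is
  meaningful only for \<open>Z \<in> L2_space M\<close>.\<close>

definition L2_norm :: "'a measure \<Rightarrow> ('a \<Rightarrow> real) \<Rightarrow> real" where
  "L2_norm M Z = sqrt (prob_space.expectation M (\<lambda>\<omega>. \<bar>Z \<omega>\<bar>\<^sup>2))"

definition iid_copies :: "'a measure \<Rightarrow> ('a \<Rightarrow> real) \<Rightarrow> nat \<Rightarrow> (nat \<Rightarrow> 'a \<Rightarrow> real) \<Rightarrow> bool" where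
  "iid_copies M Z n S \<longleftrightarrow>
     prob_space.indep_vars M (\<lambda>_. borel) S {1..n} \<and>
     (\<forall>i\<in>{1..n}. distr M borel (S i) = distr M borel Z)"

definition MC_estimator :: "nat \<Rightarrow> (nat \<Rightarrow> 'a \<Rightarrow> real) \<Rightarrow> 'a \<Rightarrow> real" where
  "MC_estimator n S \<omega> = inverse (real n) * (\<Sum>i=1..n. S i \<omega>)"

text \<open>\<open>S l i\<close> is the \<open>i\<close>-th sample on level \<open>l\<close>. Across levels only the Monte Carlo
  estimators, not the whole sample families, are required to be independent.\<close>

definition MLMC_samples ::
    "'a measure \<Rightarrow> (nat \<Rightarrow> 'a \<Rightarrow> real) \<Rightarrow> nat \<Rightarrow> (nat \<Rightarrow> nat) \<Rightarrow> (nat \<Rightarrow> nat \<Rightarrow> 'a \<Rightarrow> real) \<Rightarrow> bool" where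
  "MLMC_samples M Y L N S \<longleftrightarrow>
     iid_copies M (Y 0) (N 0) (S 0) \<and>
     (\<forall>l\<in>{1..L}. iid_copies M (\<lambda>\<omega>. Y l \<omega> - Y (l - 1) \<omega>) (N l) (S l)) \<and>
     prob_space.indep_vars M (\<lambda>_. borel) (\<lambda>l. MC_estimator (N l) (S l)) {0..L}"

definition MLMC_estimator ::
    "nat \<Rightarrow> (nat \<Rightarrow> nat) \<Rightarrow> (nat \<Rightarrow> nat \<Rightarrow> 'a \<Rightarrow> real) \<Rightarrow> 'a \<Rightarrow> real" where
  "MLMC_estimator L N S \<omega> =
     MC_estimator (N 0) (S 0) \<omega> + (\<Sum>l=1..L. MC_estimator (N l) (S l) \<omega>)"

end

theory Submission
  imports Defs
begin

text \<open>By independence the estimator \<open>T\<close> has mean \<open>\<mu> = E[Y\<^sub>L]\<close> (the levels telescope) and variance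
  \<open>V\<close> equal to the weighted sum of the level variances. With \<open>c = E[Y]\<close> and \<open>e = \<bar>c - \<mu>\<bar>\<close>, the upper
  bound is the reverse triangle inequality \<open>\<bar>e - \<bar>c - T\<bar>\<bar> \<le> \<bar>T - \<mu>\<bar>\<close>. The lower bound is the reverse
  triangle inequality in \<open>L\<^sup>2\<close>, since \<open>E[\<bar>c - T\<bar>\<^sup>2] = e\<^sup>2 + V\<close>.\<close>

context prob_space
begin

section \<open>Square-integrable variables: vector space operations and absolute values\<close>

lemma L2_space_iff:
  "Z \<in> L2_space M \<longleftrightarrow> random_variable borel Z \<and> integrable M (\<lambda>\<omega>. (Z \<omega>)\<^sup>2)"
  by (simp add: L2_space_def)

lemma L2_space_integrable: "Z \<in> L2_space M \<Longrightarrow> integrable M Z"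
  by (auto simp: L2_space_iff intro: square_integrable_imp_integrable)

lemma L2_space_const: "(\<lambda>_. c) \<in> L2_space M"
  by (simp add: L2_space_iff)

lemma L2_space_mult_left:
  assumes "Z \<in> L2_space M"
  shows "(\<lambda>\<omega>. c * Z \<omega>) \<in> L2_space M"
  using assms by (auto simp: L2_space_iff power_mult_distrib)

lemma L2_space_abs:
  assumes "Z \<in> L2_space M"
  shows "(\<lambda>\<omega>. \<bar>Z \<omega>\<bar>) \<in> L2_space M"
  using assms by (auto simp: L2_space_iff)

lemma L2_space_add:
  assumes "Z \<in> L2_space M" "W \<in> L2_space M"
  shows "(\<lambda>\<omega>. Z \<omega> + W \<omega>) \<in> L2_space M"
proof -
  have [measurable]: "random_variable borel Z" "random_variable borel W"
    and int: "integrable M (\<lambda>\<omega>. (Z \<omega>)\<^sup>2)" "integrable M (\<lambda>\<omega>. (W \<omega>)\<^sup>2)"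
    using assms by (auto simp: L2_space_iff)
  have "integrable M (\<lambda>\<omega>. (Z \<omega> + W \<omega>)\<^sup>2)"
  proof (rule Bochner_Integration.integrable_bound)
    show "integrable M (\<lambda>\<omega>. 2 * (Z \<omega>)\<^sup>2 + 2 * (W \<omega>)\<^sup>2)"
      using int by auto
    \<comment> \<open>The right side exceeds the left by exactly
      \<open>(Z \<omega> - W \<omega>)\<^sup>2\<close>.\<close>
    have "(Z \<omega> + W \<omega>)\<^sup>2 \<le> 2 * (Z \<omega>)\<^sup>2 + 2 * (W \<omega>)\<^sup>2" for \<omega>
      using zero_le_power2[of "Z \<omega> - W \<omega>"] by (simp add: power2_sum power2_diff)
    then show "AE \<omega> in M. norm ((Z \<omega> + W \<omega>)\<^sup>2) \<le> norm (2 * (Z \<omega>)\<^sup>2 + 2 * (W \<omega>)\<^sup>2)"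
      by simp
  qed simp
  then show ?thesis
    by (simp add: L2_space_iff)
qed

lemma L2_space_diff:
  assumes "Z \<in> L2_space M" "W \<in> L2_space M"
  shows "(\<lambda>\<omega>. Z \<omega> - W \<omega>) \<in> L2_space M"
  using L2_space_add[OF assms(1) L2_space_mult_left[OF assms(2), of "-1"]] by simp

lemma L2_space_sum:
  assumes "\<And>i. i \<in> I \<Longrightarrow> X i \<in> L2_space M"
  shows "(\<lambda>\<omega>. \<Sum>i\<in>I. X i \<omega>) \<in> L2_space M"
  \<comment> \<open>For infinite \<open>I\<close> the sum is 0 by convention, so this case, like the
    empty one, is a constant.\<close>
  using assms by (induction I rule: infinite_finite_induct)
    (simp_all add: L2_space_const L2_space_add)

section \<open>Variance under scaling and independence\<close>

text \<open>Real factors pass through the Bochner integral unconditionally, since the default value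
  0 for non-integrable functions is compatible with scaling.\<close>

lemma variance_mult_left:
  fixes X :: "'a \<Rightarrow> real"
  shows "variance (\<lambda>\<omega>. c * X \<omega>) = c\<^sup>2 * variance X"
  by (simp add: power_mult_distrib flip: right_diff_distrib)

text \<open>Independence factors the mean of the product, so the cross term of the second moment
  cancels against that of the squared mean.\<close>

lemma variance_add_indep:
  fixes X W :: "'a \<Rightarrow> real"
  assumes X: "X \<in> L2_space M" and W: "W \<in> L2_space M"
    and indep: "indep_var borel X borel W"
  shows "variance (\<lambda>\<omega>. X \<omega> + W \<omega>) = variance X + variance W"
proof -
  note [simp] = L2_space_integrable[OF X] L2_space_integrable[OF W]
  have [simp]: "integrable M (\<lambda>\<omega>. (X \<omega>)\<^sup>2)" "integrable M (\<lambda>\<omega>. (W \<omega>)\<^sup>2)"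
    "integrable M (\<lambda>\<omega>. (X \<omega> + W \<omega>)\<^sup>2)"
    using X W L2_space_add[OF X W] by (auto simp: L2_space_iff)
  have [simp]: "integrable M (\<lambda>\<omega>. X \<omega> * W \<omega>)"
    by (rule indep_var_integrable[OF indep]) auto
  have prod: "expectation (\<lambda>\<omega>. X \<omega> * W \<omega>) = expectation X * expectation W"
    by (rule indep_var_lebesgue_integral[OF indep]) auto
  have "expectation (\<lambda>\<omega>. (X \<omega> + W \<omega>)\<^sup>2)
      = expectation (\<lambda>\<omega>. (X \<omega>)\<^sup>2 + (W \<omega>)\<^sup>2 + 2 * (X \<omega> * W \<omega>))"
    by (simp add: power2_sum mult.assoc)
  also have "\<dots> = expectation (\<lambda>\<omega>. (X \<omega>)\<^sup>2) + expectation (\<lambda>\<omega>. (W \<omega>)\<^sup>2)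
      + 2 * (expectation X * expectation W)"
    by (simp add: prod)
  finally have "expectation (\<lambda>\<omega>. (X \<omega> + W \<omega>)\<^sup>2) - (expectation (\<lambda>\<omega>. X \<omega> + W \<omega>))\<^sup>2
      = variance X + variance W"
    by (simp add: variance_eq power2_sum)
  then show ?thesis
    by (subst variance_eq) auto
qed

lemma variance_sum_indep:
  fixes X :: "'i \<Rightarrow> 'a \<Rightarrow> real"
  assumes "finite I" and "\<And>i. i \<in> I \<Longrightarrow> X i \<in> L2_space M"
    and "indep_vars (\<lambda>_. borel) X I"
  shows "variance (\<lambda>\<omega>. \<Sum>i\<in>I. X i \<omega>) = (\<Sum>i\<in>I. variance (X i))"
  using assms
proof (induction I rule: finite_induct)
  case (insert i I)
  \<comment> \<open>The new variable is independent of the sum of the others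
    (\<open>indep_vars_sum\<close>), which reduces the step to two summands.\<close>
  then have "variance (\<lambda>\<omega>. X i \<omega> + (\<Sum>j\<in>I. X j \<omega>))
      = variance (X i) + variance (\<lambda>\<omega>. \<Sum>j\<in>I. X j \<omega>)"
    by (intro variance_add_indep L2_space_sum indep_vars_sum) auto
  moreover have "indep_vars (\<lambda>_. borel) X I"
    using insert.prems(2) by (rule indep_vars_subset) auto
  ultimately show ?case
    using insert by simp
qed simp

section \<open>Moments of the Monte Carlo estimators\<close>

text \<open>By change of variables, each quantity is an integral against the common law. This
  transfers the moments of \<open>Z\<close> to its samples.\<close>

lemma same_distr_moments:
  fixes X Z :: "'a \<Rightarrow> real"
  assumes [measurable]: "random_variable borel X" and Z: "Z \<in> L2_space M"
    and distr: "distr M borel X = distr M borel Z"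
  shows "X \<in> L2_space M" "expectation X = expectation Z" "variance X = variance Z"
proof -
  have [measurable]: "random_variable borel Z"
    using Z by (simp add: L2_space_iff)
  have expect: "expectation (\<lambda>\<omega>. f (X \<omega>)) = expectation (\<lambda>\<omega>. f (Z \<omega>))"
    if [measurable]: "f \<in> borel_measurable borel" for f :: "real \<Rightarrow> real"
    using integral_distr[of X M borel f] integral_distr[of Z M borel f] by (simp add: distr)
  \<comment> \<open>Equal integrals do not give integrability, because of the default value 0; it is
    transferred separately.\<close>
  have "integrable M (\<lambda>\<omega>. (X \<omega>)\<^sup>2) \<longleftrightarrow> integrable M (\<lambda>\<omega>. (Z \<omega>)\<^sup>2)"
    using integrable_distr_eq[of X M borel "\<lambda>x. x\<^sup>2"] integrable_distr_eq[of Z M borel "\<lambda>x. x\<^sup>2"]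
    by (simp add: distr)
  then show "X \<in> L2_space M"
    using Z by (simp add: L2_space_iff)
  show mean: "expectation X = expectation Z"
    using expect[of "\<lambda>x. x"] by simp
  show "variance X = variance Z"
    using expect[of "\<lambda>x. (x - expectation Z)\<^sup>2"] by (simp add: mean)
qed

text \<open>The sample variances add up to \<open>n\<close> times that of \<open>Z\<close>, and the
  squared prefactor reduces this to \<open>inverse (real n)\<close> times it.\<close>

lemma MC_estimator_moments:
  assumes "iid_copies M Z n S" and Z: "Z \<in> L2_space M" and "n \<ge> 1"
  shows "MC_estimator n S \<in> L2_space M"
    and "expectation (MC_estimator n S) = expectation Z"
    and "variance (MC_estimator n S) = inverse (real n) * variance Z"
proof -
  have indep: "indep_vars (\<lambda>_. borel) S {1..n}"
    and distr: "\<And>i. i \<in> {1..n} \<Longrightarrow> distr M borel (S i) = distr M borel Z"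
    using assms(1) by (auto simp: iid_copies_def)
  have rv: "random_variable borel (S i)" if "i \<in> {1..n}" for i
    using indep that by (auto simp: indep_vars_def2)
  note S = same_distr_moments[OF rv Z distr]
  have MC: "MC_estimator n S = (\<lambda>\<omega>. inverse (real n) * (\<Sum>i=1..n. S i \<omega>))"
    by (simp add: MC_estimator_def fun_eq_iff)
  have sum_L2: "(\<lambda>\<omega>. \<Sum>i=1..n. S i \<omega>) \<in> L2_space M"
    by (intro L2_space_sum S(1))
  then show "MC_estimator n S \<in> L2_space M"
    unfolding MC by (rule L2_space_mult_left)
  have "expectation (\<lambda>\<omega>. \<Sum>i=1..n. S i \<omega>) = (\<Sum>i=1..n. expectation (S i))"
    by (intro Bochner_Integration.integral_sum L2_space_integrable S(1))
  \<comment> \<open>With \<open>n \<ge> 1\<close> the prefactor cancels the \<open>n\<close> equal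
    means; for \<open>n = 0\<close> the estimator would be constantly 0.\<close>
  then show "expectation (MC_estimator n S) = expectation Z"
    using \<open>n \<ge> 1\<close> by (simp add: MC S(2))
  have "variance (\<lambda>\<omega>. \<Sum>i=1..n. S i \<omega>) = (\<Sum>i=1..n. variance (S i))"
    by (intro variance_sum_indep S(1) indep) auto
  also have "\<dots> = real n * variance Z"
    by (simp add: S(3))
  moreover have "variance (MC_estimator n S)
      = (inverse (real n))\<^sup>2 * variance (\<lambda>\<omega>. \<Sum>i=1..n. S i \<omega>)"
    unfolding MC by (rule variance_mult_left)
  ultimately show "variance (MC_estimator n S) = inverse (real n) * variance Z"
    using \<open>n \<ge> 1\<close> by (simp add: power2_eq_square)
qed

text \<open>All levels are treated as one family over \<open>{0..L}\<close>: linearity gives the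
  mean, and independence of the level estimators gives the variance.\<close>

lemma MLMC_estimator_moments:
  assumes Y: "\<And>l. Y l \<in> L2_space M" and N: "\<forall>l\<le>L. N l \<ge> 1"
    and samples: "MLMC_samples M Y L N S"
  shows "MLMC_estimator L N S \<in> L2_space M"
    and "expectation (MLMC_estimator L N S) = expectation (Y L)"
    and "variance (MLMC_estimator L N S) = inverse (real (N 0)) * variance (Y 0)
      + (\<Sum>l=1..L. inverse (real (N l)) * variance (\<lambda>\<omega>. Y l \<omega> - Y (l - 1) \<omega>))"
proof -
  let ?E = "\<lambda>l. MC_estimator (N l) (S l)"
  have head: "iid_copies M (Y 0) (N 0) (S 0)"
    and tail: "\<And>l. l \<in> {1..L} \<Longrightarrow> iid_copies M (\<lambda>\<omega>. Y l \<omega> - Y (l - 1) \<omega>) (N l) (S l)"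
    and indep: "indep_vars (\<lambda>_. borel) ?E {0..L}"
    using samples by (auto simp: MLMC_samples_def)
  note E0 = MC_estimator_moments[OF head Y N[rule_format, OF le0]]
  \<comment> \<open>Level 0 stays apart: on naturals \<open>0 - 1 = 0\<close>, so the difference
    formula would give 0 there.\<close>
  have E: "?E l \<in> L2_space M"
    "expectation (?E l) = expectation (Y l) - expectation (Y (l - 1))"
    "variance (?E l) = inverse (real (N l)) * variance (\<lambda>\<omega>. Y l \<omega> - Y (l - 1) \<omega>)"
    if "l \<in> {1..L}" for l
    using MC_estimator_moments[OF tail[OF that] L2_space_diff[OF Y Y]] N that
    by (simp_all add: L2_space_integrable[OF Y])
  have E_L2: "?E l \<in> L2_space M" if "l \<in> {0..L}" for l
    using E0(1) E(1)[of l] that by (cases "l = 0") auto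
  have split: "sum f {0..L} = f 0 + sum f {1..L}" for f :: "nat \<Rightarrow> real"
    by (simp add: sum.atLeast_Suc_atMost)
  have MLMC: "MLMC_estimator L N S = (\<lambda>\<omega>. \<Sum>l=0..L. ?E l \<omega>)"
    by (simp add: MLMC_estimator_def fun_eq_iff split)
  show "MLMC_estimator L N S \<in> L2_space M"
    unfolding MLMC by (intro L2_space_sum E_L2)
  have "expectation (MLMC_estimator L N S) = (\<Sum>l=0..L. expectation (?E l))"
    unfolding MLMC by (intro Bochner_Integration.integral_sum L2_space_integrable E_L2)
  also have "\<dots> = expectation (Y 0) + (\<Sum>l=1..L. expectation (Y l) - expectation (Y (l - 1)))"
    unfolding split using E0(2) E(2) by simp
  also have "\<dots> = expectation (Y L)"
    using sum_telescope''[of 0 L "\<lambda>l. expectation (Y l)"] by (simp add: atLeastSucAtMost_greaterThanAtMost)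
  finally show "expectation (MLMC_estimator L N S) = expectation (Y L)" .
  have "variance (MLMC_estimator L N S) = (\<Sum>l=0..L. variance (?E l))"
    unfolding MLMC by (intro variance_sum_indep E_L2 indep) auto
  then show "variance (MLMC_estimator L N S) = inverse (real (N 0)) * variance (Y 0)
      + (\<Sum>l=1..L. inverse (real (N l)) * variance (\<lambda>\<omega>. Y l \<omega> - Y (l - 1) \<omega>))"
    unfolding split using E0(3) E(3) by simp
qed

section \<open>Mean-square bounds for the absolute error\<close>

lemma L2_norm_eq: "L2_norm M Z = sqrt (expectation (\<lambda>\<omega>. (Z \<omega>)\<^sup>2))"
  by (simp add: L2_norm_def)

text \<open>Only the mean and variance of \<open>T\<close> enter, so the multilevel structure is
  irrelevant here. Membership in \<open>L2_space M\<close> makes the norm meaningful.\<close>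

lemma L2_norm_abs_error_bounds:
  fixes c :: real
  assumes T: "T \<in> L2_space M"
  defines "e \<equiv> \<bar>c - expectation T\<bar>"
  shows "(\<lambda>\<omega>. e - \<bar>c - T \<omega>\<bar>) \<in> L2_space M"
    and "- e + sqrt (e\<^sup>2 + variance T) \<le> L2_norm M (\<lambda>\<omega>. e - \<bar>c - T \<omega>\<bar>)"
    and "L2_norm M (\<lambda>\<omega>. e - \<bar>c - T \<omega>\<bar>) \<le> sqrt (variance T)"
proof -
  define X where "X = (\<lambda>\<omega>. \<bar>c - T \<omega>\<bar>)"
  have X: "X \<in> L2_space M"
    unfolding X_def by (intro L2_space_abs L2_space_diff L2_space_const T)
  show L2: "(\<lambda>\<omega>. e - \<bar>c - T \<omega>\<bar>) \<in> L2_space M"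
    using L2_space_diff[OF L2_space_const X, of e] by (simp add: X_def)
  have int: "integrable M X" "integrable M T" "integrable M (\<lambda>\<omega>. (X \<omega>)\<^sup>2)"
    "integrable M (\<lambda>\<omega>. (T \<omega>)\<^sup>2)"
    using L2_space_integrable[OF X] L2_space_integrable[OF T] X T
    unfolding L2_space_iff by blast+
  \<comment> \<open>Bias-variance decomposition of the mean-square error, so that \<open>?s\<close>
    below is the norm of \<open>X\<close>.\<close>
  have "expectation (\<lambda>\<omega>. (X \<omega>)\<^sup>2) = expectation (\<lambda>\<omega>. c\<^sup>2 + (T \<omega>)\<^sup>2 - 2 * c * T \<omega>)"
    by (simp add: X_def power2_diff)
  also have "\<dots> = c\<^sup>2 + expectation (\<lambda>\<omega>. (T \<omega>)\<^sup>2) - 2 * c * expectation T"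
    using int by (simp add: prob_space)
  also have "\<dots> = e\<^sup>2 + variance T"
    unfolding variance_eq[OF int(2,4)] by (simp add: e_def power2_diff)
  finally have second_moment: "expectation (\<lambda>\<omega>. (X \<omega>)\<^sup>2) = e\<^sup>2 + variance T" .
  let ?s = "sqrt (e\<^sup>2 + variance T)"
  have s_sq: "?s\<^sup>2 = e\<^sup>2 + variance T"
    by (simp add: variance_positive)
  \<comment> \<open>The variance of \<open>X\<close> is nonnegative; hence its mean is at most its
    norm \<open>?s\<close>.\<close>
  have "(expectation X)\<^sup>2 \<le> expectation (\<lambda>\<omega>. (X \<omega>)\<^sup>2)"
    using variance_positive[of X] int by (simp add: variance_eq)
  then have mean_le: "expectation X \<le> ?s"
    unfolding second_moment by (rule real_le_rsqrt)
  have "expectation (\<lambda>\<omega>. (e - X \<omega>)\<^sup>2) = expectation (\<lambda>\<omega>. e\<^sup>2 + (X \<omega>)\<^sup>2 - 2 * e * X \<omega>)"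
    by (simp add: power2_diff)
  also have "\<dots> = e\<^sup>2 + (e\<^sup>2 + variance T) - 2 * e * expectation X"
    using int by (simp add: prob_space flip: second_moment)
  \<comment> \<open>Since \<open>e \<ge> 0\<close>, replacing the mean of \<open>X\<close> by the
    larger \<open>?s\<close> decreases the expression and leaves the perfect square
    \<open>(?s - e)\<^sup>2\<close>.\<close>
  also have "\<dots> \<ge> e\<^sup>2 + (e\<^sup>2 + variance T) - 2 * e * ?s"
    using mult_left_mono[OF mean_le, of "2 * e"] by (simp add: e_def)
  finally have "(?s - e)\<^sup>2 \<le> expectation (\<lambda>\<omega>. (e - X \<omega>)\<^sup>2)"
    unfolding power2_diff[of ?s e] s_sq by (simp add: mult_ac add_ac)
  then show "- e + ?s \<le> L2_norm M (\<lambda>\<omega>. e - \<bar>c - T \<omega>\<bar>)"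
    unfolding L2_norm_eq X_def by (simp add: real_le_rsqrt)
  have "expectation (\<lambda>\<omega>. (e - \<bar>c - T \<omega>\<bar>)\<^sup>2) \<le> variance T"
  proof (rule integral_mono)
    show "integrable M (\<lambda>\<omega>. (e - \<bar>c - T \<omega>\<bar>)\<^sup>2)"
      using L2 by (simp add: L2_space_iff)
    show "integrable M (\<lambda>\<omega>. (T \<omega> - expectation T)\<^sup>2)"
      using L2_space_diff[OF T L2_space_const] by (simp add: L2_space_iff)
    \<comment> \<open>Comparing squares amounts to comparing absolute values, where the reverse
      triangle inequality applies pointwise.\<close>
    show "(e - \<bar>c - T \<omega>\<bar>)\<^sup>2 \<le> (T \<omega> - expectation T)\<^sup>2" for \<omega>
      unfolding abs_le_square_iff[symmetric] e_def by linarith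
  qed
  then show "L2_norm M (\<lambda>\<omega>. e - \<bar>c - T \<omega>\<bar>) \<le> sqrt (variance T)"
    unfolding L2_norm_eq by simp
qed

end

theorem proposition2p4:
  fixes M :: "'a measure"
    and Y :: "'a \<Rightarrow> real"
    and Yl :: "nat \<Rightarrow> 'a \<Rightarrow> real"
    and L :: nat
    and N :: "nat \<Rightarrow> nat"
    and S :: "nat \<Rightarrow> nat \<Rightarrow> 'a \<Rightarrow> real"
  assumes "prob_space M"
    and "Y \<in> L2_space M"
    and "\<And>l. Yl l \<in> L2_space M"
    and "(\<lambda>l. \<bar>prob_space.expectation M (\<lambda>\<omega>. Y \<omega> - Yl l \<omega>)\<bar>) \<longlonglongrightarrow> 0"
    and "L \<ge> 1"
    and "\<And>l. l \<le> L \<Longrightarrow> N l \<ge> 1"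
    and "MLMC_samples M Yl L N S"
  shows "(\<lambda>\<omega>. \<bar>prob_space.expectation M (\<lambda>\<omega>. Y \<omega> - Yl L \<omega>)\<bar>
                  - \<bar>prob_space.expectation M Y - MLMC_estimator L N S \<omega>\<bar>)
              \<in> L2_space M
       \<and> L2_norm M (\<lambda>\<omega>. \<bar>prob_space.expectation M (\<lambda>\<omega>. Y \<omega> - Yl L \<omega>)\<bar>
                  - \<bar>prob_space.expectation M Y - MLMC_estimator L N S \<omega>\<bar>)
              \<ge> - \<bar>prob_space.expectation M (\<lambda>\<omega>. Y \<omega> - Yl L \<omega>)\<bar>
                + sqrt (\<bar>prob_space.expectation M (\<lambda>\<omega>. Y \<omega> - Yl L \<omega>)\<bar>\<^sup>2
                  + inverse (real (N 0)) * prob_space.variance M (Yl 0)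
                  + (\<Sum>l=1..L. inverse (real (N l)) *
                       prob_space.variance M (\<lambda>\<omega>. Yl l \<omega> - Yl (l - 1) \<omega>)))
       \<and> L2_norm M (\<lambda>\<omega>. \<bar>prob_space.expectation M (\<lambda>\<omega>. Y \<omega> - Yl L \<omega>)\<bar>
                  - \<bar>prob_space.expectation M Y - MLMC_estimator L N S \<omega>\<bar>)
              \<le> sqrt (inverse (real (N 0)) * prob_space.variance M (Yl 0)
                  + (\<Sum>l=1..L. inverse (real (N l)) *
                       prob_space.variance M (\<lambda>\<omega>. Yl l \<omega> - Yl (l - 1) \<omega>)))"
proof -
  interpret prob_space M by fact
  have N: "\<forall>l\<le>L. N l \<ge> 1"
    using assms(6) by blast
  note T = MLMC_estimator_moments[OF assms(3) N assms(7)]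
  \<comment> \<open>Rewrites the bias through the mean of the estimator, which is the form of
    \<open>e\<close> for \<open>c = expectation Y\<close>.\<close>
  have err: "expectation (\<lambda>\<omega>. Y \<omega> - Yl L \<omega>) = expectation Y - expectation (MLMC_estimator L N S)"
    using assms(2,3) by (simp add: T(2) L2_space_integrable)
  show ?thesis
    \<comment> \<open>Reassociation groups the level variances into the single term that
      \<open>T(3)\<close> equates with the variance of the estimator.\<close>
    unfolding err add.assoc
    using L2_norm_abs_error_bounds[OF T(1), of "expectation Y", unfolded T(3)] by blast
qed

end
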